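(* For every real $d>0$ we have $\widehat R(d)\le \sqrt{d}$. Moreover, if $d$ is an integer that can be written as $d=p^k+1$, where $p$ is a prime number and $k\ge 1$ is an integer, then $R(d)\ge\sqrt{d-1}$.
   Context: All graphs are finite and simple. For a graph $G$ of order $n$ with adjacency eigenvalues $\lambda_1\ge\lambda_2\ge\cdots\ge\lambda_n$, let $H=\lfloor\frac{n+1}{2}\rfloor$ and $L=\lceil\frac{n+1}{2}\rceil$; the HL-index of $G$ is $R(G)=\max\{|\lambda_H|,|\lambda_L|\}$. For a real $d$, $R(d)=\sup\{R(G) : \Delta(G)\le d\}$, where $\Delta(G)$ is the maximum degree, and $\widehat R(d)=\sup\{R(G): \bar d(G)\le d\}$, where $\bar d(G)=2|E(G)|/|V(G)|$ is the average degree of $G$. *)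

theory Defs
  imports
    Complex_Main
    "HOL-Library.Extended_Real"
    "HOL-Library.Multiset"
    "HOL-Computational_Algebra.Computational_Algebra"
    "Graph_Theory.Pair_Digraph"
    "Jordan_Normal_Form.Char_Poly"
begin

text \<open>
  A finite simple graph is a \<^locale>\<open>pair_graph\<close>: a finite loop-free digraph without parallel
  arcs whose arc relation is symmetric. An undirected edge \<open>uv\<close> is the pair of opposite arcs
  \<open>(u, v)\<close>, \<open>(v, u)\<close>. A \<^locale>\<open>pair_graph\<close> may have no vertices; the eigenvalues indexed below and
  the two degree parameters are meaningful only if there is at least one.
\<close>

definition num_edges :: "'a pair_pre_digraph \<Rightarrow> nat" where
  "num_edges G = card ((\<lambda>(u, v). {u, v}) ` parcs G)"

definition max_degree :: "'a pair_pre_digraph \<Rightarrow> nat" where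
  "max_degree G = Max (out_degree (with_proj G) ` pverts G)"

definition avg_degree :: "'a pair_pre_digraph \<Rightarrow> real" where
  "avg_degree G = 2 * real (num_edges G) / real (card (pverts G))"

text \<open>
  Rows and columns are indexed by the vertices in increasing order; the spectrum does not depend
  on this choice.
\<close>

definition adj_matrix :: "'a::linorder pair_pre_digraph \<Rightarrow> real mat" where
  "adj_matrix G =
     (let vs = sorted_list_of_set (pverts G); n = card (pverts G)
      in mat n n (\<lambda>(i, j). if (vs ! i, vs ! j) \<in> parcs G then 1 else 0))"

text \<open>
  The real roots of the characteristic polynomial, in decreasing order and repeated according to
  their multiplicity. As the matrix is real and symmetric, these are all its eigenvalues, and
  there are \<^term>\<open>card (pverts G)\<close> of them.
\<close>

definition eigenvalue_list :: "'a::linorder pair_pre_digraph \<Rightarrow> real list" where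
  "eigenvalue_list G = rev (sorted_list_of_multiset (proots (char_poly (adj_matrix G))))"

text \<open>Eigenvalues are numbered from 1.\<close>

definition nth_eigenvalue :: "'a::linorder pair_pre_digraph \<Rightarrow> nat \<Rightarrow> real" where
  "nth_eigenvalue G i = eigenvalue_list G ! (i - 1)"

definition HL_index :: "'a::linorder pair_pre_digraph \<Rightarrow> real" where
  "HL_index G =
     (let n = card (pverts G);
          H = nat \<lfloor>(real n + 1) / 2\<rfloor>;
          L = nat \<lceil>(real n + 1) / 2\<rceil>
      in max \<bar>nth_eigenvalue G H\<bar> \<bar>nth_eigenvalue G L\<bar>)"

text \<open>
  Every finite graph is isomorphic to one whose vertices are natural numbers, so the suprema
  range over those. They are taken in the extended reals, where the supremum of an unbounded set
  is \<open>\<infinity>\<close>; in particular an upper bound on them includes boundedness.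
\<close>

definition HL_max_degree_sup :: "real \<Rightarrow> ereal" where
  "HL_max_degree_sup d =
     (SUP G \<in> {G :: nat pair_pre_digraph.
                 pair_graph G \<and> pverts G \<noteq> {} \<and> real (max_degree G) \<le> d}. ereal (HL_index G))"

definition HL_avg_degree_sup :: "real \<Rightarrow> ereal" where
  "HL_avg_degree_sup d =
     (SUP G \<in> {G :: nat pair_pre_digraph.
                 pair_graph G \<and> pverts G \<noteq> {} \<and> avg_degree G \<le> d}. ereal (HL_index G))"

end

theory Submission
  imports Defs "Jordan_Normal_Form.Schur_Decomposition"
begin

text \<open>
  Upper bound: the eigenvalues of a graph sum to \<open>0\<close> and their squares to \<open>2 |E|\<close>. If
  \<open>t\<close> is the absolute value of a median eigenvalue, then, up to a global sign, at least half of
  the eigenvalues are \<open>\<ge> t\<close>; comparing them with \<open>t\<close> and the others with \<open>-t\<close> shows that the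
  mean of the squares is at least \<open>t\<^sup>2\<close>.

  Lower bound: the incidence matrix of the Desarguesian projective plane of order \<open>q\<close> satisfies
  \<open>M M\<^sup>T = M\<^sup>T M = q I + J\<close>, so every eigenvalue of its incidence graph, which is
  \<open>(q + 1)\<close>-regular, has square at least \<open>q\<close>. The field with \<open>q\<close> elements is realised as
  \<open>\<int>[\<zeta>] / P\<close>, where \<open>\<zeta>\<close> is a primitive \<open>(q - 1)\<close>-st root of unity in the complex numbers and
  \<open>P\<close> is a maximal ideal containing \<open>p\<close>.
\<close>

section \<open>Spectra of real symmetric matrices\<close>

text \<open>For an eigenvector \<open>v\<close>, the form \<open>Q\<close> of \<open>A\<close> at
  \<open>v\<close> equals \<open>z * N\<close>, where \<open>N > 0\<close> is the squared norm.
  Symmetry of the real entries makes \<open>Q\<close> its own conjugate, so \<open>z = Q / N\<close>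
  is real.\<close>

lemma symmetric_real_mat_eigenvalue_real:
  fixes A :: "real mat"
  assumes A: "A \<in> carrier_mat n n"
    and sym: "\<And>i j. i < n \<Longrightarrow> j < n \<Longrightarrow> A $$ (i, j) = A $$ (j, i)"
    and ev: "eigenvalue (map_mat complex_of_real A) z"
  shows "z \<in> \<real>"
proof -
  let ?A = "map_mat complex_of_real A"
  obtain v where v: "v \<in> carrier_vec n" "v \<noteq> 0\<^sub>v n" "?A *\<^sub>v v = z \<cdot>\<^sub>v v"
    using ev A unfolding eigenvalue_def eigenvector_def by auto
  have row: "(\<Sum>j<n. complex_of_real (A $$ (i, j)) * v $ j) = z * v $ i" if "i < n" for i
  proof -
    have "(?A *\<^sub>v v) $ i = (\<Sum>j<n. complex_of_real (A $$ (i, j)) * v $ j)"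
      using that A v(1) by (auto simp: scalar_prod_def lessThan_atLeast0 intro!: sum.cong)
    thus ?thesis using that v by simp
  qed
  define Q where "Q = (\<Sum>i<n. \<Sum>j<n. cnj (v $ i) * complex_of_real (A $$ (i, j)) * v $ j)"
  define N where "N = (\<Sum>i<n. (cmod (v $ i))\<^sup>2)"
  have "Q = (\<Sum>i<n. cnj (v $ i) * (z * v $ i))"
    unfolding Q_def by (intro sum.cong) (simp_all add: mult.assoc row flip: sum_distrib_left)
  also have "\<dots> = z * of_real N"
    unfolding N_def of_real_sum sum_distrib_left
    by (intro sum.cong) (simp_all only: complex_norm_square mult_ac)
  finally have Q: "Q = z * of_real N" .
  have "cnj Q = (\<Sum>i<n. \<Sum>j<n. v $ i * complex_of_real (A $$ (i, j)) * cnj (v $ j))"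
    by (simp add: Q_def)
  also have "\<dots> = (\<Sum>j<n. \<Sum>i<n. v $ i * complex_of_real (A $$ (i, j)) * cnj (v $ j))"
    by (rule sum.swap)
  also have "\<dots> = Q"
    unfolding Q_def by (intro sum.cong) (auto simp: sym mult_ac)
  finally have "Q \<in> \<real>" by (simp add: Reals_cnj_iff)
  obtain i where "i < n" "v $ i \<noteq> 0" using v(1,2) by (metis eq_vecI carrier_vecD index_zero_vec)
  hence "N > 0" unfolding N_def by (intro sum_pos2[of _ i]) auto
  hence "z = Q / of_real N" using Q by simp
  thus ?thesis using \<open>Q \<in> \<real>\<close> by (metis Reals_divide Reals_of_real)
qed

text \<open>Over the complex numbers the characteristic polynomial splits. All its roots are real,
  so the factorisation descends along the injective embedding of the reals.\<close>

lemma symmetric_real_mat_char_poly_splits: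
  fixes A :: "real mat"
  assumes A: "A \<in> carrier_mat n n"
    and sym: "\<And>i j. i < n \<Longrightarrow> j < n \<Longrightarrow> A $$ (i, j) = A $$ (j, i)"
  obtains es where "char_poly A = (\<Prod>e\<leftarrow>es. [:- e, 1:])" "length es = n"
proof -
  let ?A = "map_mat complex_of_real A"
  have A': "?A \<in> carrier_mat n n" using A by simp
  from char_poly_factorized[OF A'] obtain as where
    as: "char_poly ?A = (\<Prod>a\<leftarrow>as. [:- a, 1:])" "length as = n" by blast
  interpret map_poly_inj_comm_ring_hom complex_of_real ..
  have hom: "map_poly complex_of_real (\<Prod>e\<leftarrow>es. [:- e, 1:]) = (\<Prod>e\<leftarrow>es. [:- complex_of_real e, 1:])"
    for es by (induction es) (auto simp: hom_distribs)
  have "a \<in> \<real>" if "a \<in> set as" for a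
  proof (rule symmetric_real_mat_eigenvalue_real[OF A sym])
    show "eigenvalue ?A a" unfolding eigenvalue_root_char_poly[OF A'] as(1)
      using that by (auto simp: poly_prod_list prod_list_zero_iff o_def)
  qed
  hence "map (complex_of_real \<circ> Re) as = as" by (auto intro!: map_idI simp: of_real_Re)
  hence "char_poly ?A = (\<Prod>a\<leftarrow>map (complex_of_real \<circ> Re) as. [:- a, 1:])" using as by simp
  also have "\<dots> = map_poly complex_of_real (\<Prod>e\<leftarrow>map Re as. [:- e, 1:])"
    unfolding hom by (simp add: o_def)
  finally have "char_poly A = (\<Prod>e\<leftarrow>map Re as. [:- e, 1:])"
    unfolding of_real_hom.char_poly_hom[OF A] by simp
  thus ?thesis using that[of "map Re as"] as(2) by simp
qed

lemma proots_prod_linear: "proots (\<Prod>e\<leftarrow>es. [:- e, 1:]) = mset (es :: 'a :: idom list)"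
proof -
  have "proots (\<Prod>p\<leftarrow>map (\<lambda>e. [:- e, 1:]) es. p) = (\<Sum>p\<leftarrow>map (\<lambda>e. [:- e, 1:]) es. proots p)"
    by (rule proots_prod_list) auto
  also have "\<dots> = mset es" by (induction es) auto
  finally show ?thesis by simp
qed

section \<open>Traces and power sums of eigenvalues\<close>

lemma trace_mult_commute:
  fixes A B :: "'a :: comm_semiring_0 mat"
  assumes "A \<in> carrier_mat n m" "B \<in> carrier_mat m n"
  shows "(\<Sum>i<n. (A * B) $$ (i, i)) = (\<Sum>j<m. (B * A) $$ (j, j))"
proof -
  have "(\<Sum>i<n. (A * B) $$ (i, i)) = (\<Sum>i<n. \<Sum>j<m. A $$ (i, j) * B $$ (j, i))"
    using assms by (intro sum.cong) (auto simp: scalar_prod_def lessThan_atLeast0)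
  also have "\<dots> = (\<Sum>j<m. \<Sum>i<n. B $$ (j, i) * A $$ (i, j))"
    by (subst sum.swap) (simp add: mult.commute)
  also have "\<dots> = (\<Sum>j<m. (B * A) $$ (j, j))"
    using assms by (intro sum.cong) (auto simp: scalar_prod_def lessThan_atLeast0)
  finally show ?thesis .
qed

lemma trace_similar:
  fixes A B :: "'a :: comm_semiring_1 mat"
  assumes "similar_mat_wit A B P Q" "A \<in> carrier_mat n n"
  shows "(\<Sum>i<n. A $$ (i, i)) = (\<Sum>i<n. B $$ (i, i))"
proof -
  note w = similar_mat_witD2[OF assms(2,1)]
  have "(\<Sum>i<n. A $$ (i, i)) = (\<Sum>i<n. (P * (B * Q)) $$ (i, i))"
    unfolding w(3) using w by (simp add: assoc_mult_mat)
  also have "\<dots> = (\<Sum>i<n. ((B * Q) * P) $$ (i, i))"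
    using w by (intro trace_mult_commute) auto
  also have "(B * Q) * P = B" using w by (simp add: assoc_mult_mat)
  finally show ?thesis .
qed

text \<open>Schur triangularisation gives a similar upper triangular \<open>B\<close> with diagonal
  \<open>es\<close>. The diagonal of \<open>B * B\<close> consists of the squares, and traces are
  invariant under similarity.\<close>

lemma sum_eigenvalues:
  fixes A :: "real mat"
  assumes A: "A \<in> carrier_mat n n" and es: "char_poly A = (\<Prod>e\<leftarrow>es. [:- e, 1:])"
  shows "sum_list es = (\<Sum>i<n. A $$ (i, i))"
    and "(\<Sum>e\<leftarrow>es. e\<^sup>2) = (\<Sum>i<n. (A * A) $$ (i, i))"
proof -
  obtain B P Q where "schur_decomposition A es = (B, P, Q)" by (metis prod_cases3)
  from schur_decomposition[OF A es this]
  have w: "similar_mat_wit A B P Q" and tri: "upper_triangular B" and es: "es = diag_mat B" by auto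
  note wD = similar_mat_witD2[OF A w]
  have B: "B \<in> carrier_mat n n" using wD by simp
  have "sum_list es = (\<Sum>i<n. B $$ (i, i))"
    using B by (simp add: es diag_mat_def sum_list_sum_nth lessThan_atLeast0)
  thus "sum_list es = (\<Sum>i<n. A $$ (i, i))" using trace_similar[OF w A] by simp
  have w2: "similar_mat_wit (A * A) (B * B) P Q"
    using similar_mat_wit_pow[OF w, of 2] A B by (simp add: numeral_2_eq_2)
  have "(\<Sum>e\<leftarrow>es. e\<^sup>2) = (\<Sum>i<n. (B $$ (i, i))\<^sup>2)"
    using B by (simp add: es diag_mat_def sum_list_sum_nth lessThan_atLeast0)
  also have "\<dots> = (\<Sum>i<n. (B * B) $$ (i, i))"
  proof (rule sum.cong[OF refl])
    fix i assume "i \<in> {..<n}"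
    hence i: "i < n" by simp
    have "(B * B) $$ (i, i) = (\<Sum>j<n. B $$ (i, j) * B $$ (j, i))"
      using i B by (auto simp: scalar_prod_def lessThan_atLeast0)
    \<comment> \<open>For \<open>j\<close> different from \<open>i\<close>, one of the two factors
      lies strictly below the diagonal and vanishes.\<close>
    also have "\<dots> = (\<Sum>j<n. if j = i then (B $$ (i, i))\<^sup>2 else 0)"
    proof (rule sum.cong[OF refl])
      fix j assume "j \<in> {..<n}"
      thus "B $$ (i, j) * B $$ (j, i) = (if j = i then (B $$ (i, i))\<^sup>2 else 0)"
        using tri i B by (cases j i rule: linorder_cases)
          (auto simp: upper_triangular_def power2_eq_square)
    qed
    finally show "(B $$ (i, i))\<^sup>2 = (B * B) $$ (i, i)" using i by simp
  qed
  finally show "(\<Sum>e\<leftarrow>es. e\<^sup>2) = (\<Sum>i<n. (A * A) $$ (i, i))"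
    using trace_similar[OF w2 mult_carrier_mat[OF A A]] by simp
qed

text \<open>Expand \<open>\<Sum>j<n. (x j - t * s j)\<^sup>2 \<ge> 0\<close> with \<open>s = 1\<close> on \<open>J\<close> and \<open>s = -1\<close> off \<open>J\<close>.\<close>

lemma square_le_mean_square_of_half:
  fixes x :: "nat \<Rightarrow> real"
  assumes sum0: "(\<Sum>j<n. x j) = 0" and J: "J \<subseteq> {..<n}" "n \<le> 2 * card J"
    and t: "t \<ge> 0" "\<And>j. j \<in> J \<Longrightarrow> t \<le> x j"
  shows "real n * t\<^sup>2 \<le> (\<Sum>j<n. (x j)\<^sup>2)"
proof -
  define s :: "nat \<Rightarrow> real" where "s j = (if j \<in> J then 1 else -1)" for j
  have fin: "finite J" using J(1) finite_subset by blast
  \<comment> \<open>As the \<open>x j\<close> sum to \<open>0\<close>, the part off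
    \<open>J\<close>, counted with sign \<open>-1\<close>, contributes the same as the part on
    \<open>J\<close>.\<close>
  have "(\<Sum>j<n. s j * x j) = (\<Sum>j<n. 2 * (if j \<in> J then x j else 0) - x j)"
    by (intro sum.cong) (auto simp: s_def)
  also have "\<dots> = 2 * (\<Sum>j\<in>J. x j)"
    using J(1) by (simp add: sum_subtractf sum0 Int_absorb1 flip: sum_distrib_left sum.inter_restrict)
  finally have sx: "(\<Sum>j<n. s j * x j) = 2 * (\<Sum>j\<in>J. x j)" .
  have "real n * t \<le> (2 * real (card J)) * t"
    using J(2) t(1) by (intro mult_right_mono) auto
  also have "\<dots> \<le> 2 * (\<Sum>j\<in>J. x j)"
    using sum_bounded_below[of J t x] t(2) by simp
  finally have "t * (real n * t) \<le> t * (\<Sum>j<n. s j * x j)"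
    unfolding sx using t(1) by (intro mult_left_mono)
  moreover have "0 \<le> (\<Sum>j<n. (x j - t * s j)\<^sup>2)" by (intro sum_nonneg) auto
  moreover have "(\<Sum>j<n. (x j - t * s j)\<^sup>2) =
      (\<Sum>j<n. (x j)\<^sup>2 - 2 * (t * (s j * x j)) + t\<^sup>2)"
    by (intro sum.cong) (auto simp: s_def power2_eq_square algebra_simps)
  hence "(\<Sum>j<n. (x j - t * s j)\<^sup>2) =
      (\<Sum>j<n. (x j)\<^sup>2) - 2 * (t * (\<Sum>j<n. s j * x j)) + real n * t\<^sup>2"
    by (simp add: sum.distrib sum_subtractf sum_distrib_left)
  ultimately show ?thesis by (simp add: power2_eq_square algebra_simps)
qed

text \<open>In a decreasing list the \<open>i + 1\<close> entries up to position \<open>i\<close>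
  are at least \<open>xs ! i\<close>, and the \<open>n - i\<close> entries from \<open>i\<close> on
  are at most \<open>xs ! i\<close>. The two index hypotheses say that each group is at least half
  of the list. The first group serves if \<open>xs ! i\<close> is nonnegative, the second, after
  negation, if it is negative.\<close>

lemma median_square_le_mean_square:
  fixes xs :: "real list"
  assumes sorted: "sorted (rev xs)" and sum0: "sum_list xs = 0"
    and i: "i < length xs" "length xs \<le> 2 * Suc i" "2 * i \<le> length xs"
  shows "real (length xs) * (xs ! i)\<^sup>2 \<le> (\<Sum>x\<leftarrow>xs. x\<^sup>2)"
proof -
  let ?n = "length xs"
  have mono: "xs ! k \<le> xs ! j" if "j \<le> k" "k < ?n" for j k
    using sorted that by (rule sorted_rev_nth_mono)
  have sum0': "(\<Sum>j<?n. xs ! j) = 0"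
    using sum0 by (simp add: sum_list_sum_nth lessThan_atLeast0)
  have "real ?n * (xs ! i)\<^sup>2 \<le> (\<Sum>j<?n. (xs ! j)\<^sup>2)"
  proof (cases "xs ! i \<ge> 0")
    case True
    show ?thesis
      by (rule square_le_mean_square_of_half[where J = "{..i}"])
        (use True sum0' i mono in auto)
  next
    case False
    have "real ?n * (- (xs ! i))\<^sup>2 \<le> (\<Sum>j<?n. (- (xs ! j))\<^sup>2)"
      by (rule square_le_mean_square_of_half[where J = "{i..<?n}"])
        (use False sum0' i mono in \<open>auto simp: sum_negf\<close>)
    thus ?thesis by simp
  qed
  thus ?thesis by (simp add: sum_list_sum_nth lessThan_atLeast0)
qed

section \<open>Median eigenvalues and average degree\<close>

lemma adj_matrix_carrier [simp]: "adj_matrix G \<in> carrier_mat (card (pverts G)) (card (pverts G))"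
  by (simp add: adj_matrix_def Let_def)

lemma adj_matrix_index:
  assumes "i < card (pverts G)" "j < card (pverts G)"
  shows "adj_matrix G $$ (i, j) =
    (if (sorted_list_of_set (pverts G) ! i, sorted_list_of_set (pverts G) ! j) \<in> parcs G
     then 1 else 0)"
  using assms by (simp add: adj_matrix_def Let_def)

lemma (in pair_graph) arc_commute: "(u, v) \<in> parcs G \<longleftrightarrow> (v, u) \<in> parcs G"
  using pair_sym_arcs by (auto simp: symmetric_def symD)

lemma adj_matrix_sym:
  assumes "pair_graph G" "i < card (pverts G)" "j < card (pverts G)"
  shows "adj_matrix G $$ (i, j) = adj_matrix G $$ (j, i)"
  using assms by (simp add: adj_matrix_index pair_graph.arc_commute)

text \<open>The list is sorted from the multiset of real roots, hence a permutation of the roots of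
  the split characteristic polynomial; product and length do not depend on the order.\<close>

lemma eigenvalue_list:
  assumes "pair_graph G"
  shows "char_poly (adj_matrix G) = (\<Prod>e\<leftarrow>eigenvalue_list G. [:- e, 1:])"
    and "length (eigenvalue_list G) = card (pverts G)"
    and "sorted (rev (eigenvalue_list G))"
proof -
  obtain es where es: "char_poly (adj_matrix G) = (\<Prod>e\<leftarrow>es. [:- e, 1:])"
    "length es = card (pverts G)"
    using symmetric_real_mat_char_poly_splits[OF adj_matrix_carrier adj_matrix_sym[OF assms]] by blast
  have m: "mset (eigenvalue_list G) = mset es"
    by (simp add: eigenvalue_list_def es(1) proots_prod_linear)
  show "length (eigenvalue_list G) = card (pverts G)"
    using es(2) mset_eq_length[OF m] by simp
  have "mset (map (\<lambda>e. [:- e, 1:]) (eigenvalue_list G)) = mset (map (\<lambda>e. [:- e, 1:]) es)"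
    using m by (simp only: mset_map)
  thus "char_poly (adj_matrix G) = (\<Prod>e\<leftarrow>eigenvalue_list G. [:- e, 1:])"
    unfolding es(1) by (metis prod_mset_prod_list)
  show "sorted (rev (eigenvalue_list G))" by (simp add: eigenvalue_list_def)
qed

text \<open>Absence of loops makes every fibre of the map from arcs to edges consist of exactly two
  opposite arcs.\<close>

lemma (in pair_graph) card_parcs: "card (parcs G) = 2 * num_edges G"
proof -
  let ?f = "\<lambda>(u, v). {u, v}"
  have "card (parcs G) = (\<Sum>e\<in>?f ` parcs G. card {a \<in> parcs G. ?f a = e})"
    using sum.image_gen[OF pair_finite_arcs, of "\<lambda>_. 1 :: nat" ?f] by simp
  also have "\<dots> = (\<Sum>e\<in>?f ` parcs G. 2)"
  proof (rule sum.cong[OF refl])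
    fix e assume "e \<in> ?f ` parcs G"
    then obtain u v where uv: "(u, v) \<in> parcs G" "e = {u, v}" by auto
    have "{a \<in> parcs G. ?f a = e} = {(u, v), (v, u)}"
      using uv arc_commute by (auto simp: doubleton_eq_iff)
    moreover have "u \<noteq> v" using uv no_loops' by blast
    ultimately show "card {a \<in> parcs G. ?f a = e} = 2" by simp
  qed
  finally show ?thesis by (simp add: num_edges_def)
qed

text \<open>The adjacency matrix has zero diagonal since there are no loops, and the trace of its
  square counts the arcs, that is, each edge twice.\<close>

lemma sum_eigenvalue_list:
  assumes "pair_graph G"
  shows "sum_list (eigenvalue_list G) = 0"
    and "(\<Sum>x\<leftarrow>eigenvalue_list G. x\<^sup>2) = 2 * real (num_edges G)"
proof -
  interpret pair_graph G by fact
  let ?n = "card (pverts G)" and ?A = "adj_matrix G" and ?vs = "sorted_list_of_set (pverts G)"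
  note sums = sum_eigenvalues[OF adj_matrix_carrier eigenvalue_list(1)[OF assms]]
  show "sum_list (eigenvalue_list G) = 0"
    unfolding sums(1) using no_loops' by (intro sum.neutral) (auto simp: adj_matrix_index)
  have bij: "bij_betw (\<lambda>i. ?vs ! i) {..<?n} (pverts G)"
    using bij_betw_nth[of ?vs "{..<?n}" "pverts G"] pair_finite_verts by simp
  have "(\<Sum>i<?n. (?A * ?A) $$ (i, i)) = (\<Sum>i<?n. \<Sum>j<?n. ?A $$ (i, j) * ?A $$ (j, i))"
    using adj_matrix_carrier[of G]
    by (intro sum.cong) (auto simp: scalar_prod_def lessThan_atLeast0 simp del: adj_matrix_carrier)
  \<comment> \<open>By symmetry both factors are the same indicator, which is its own
    square.\<close>
  also have "\<dots> = (\<Sum>i<?n. \<Sum>j<?n. if (?vs ! i, ?vs ! j) \<in> parcs G then 1 else 0)"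
    by (intro sum.cong) (auto simp: adj_matrix_index arc_commute)
  also have "\<dots> = (\<Sum>u\<in>pverts G. \<Sum>j<?n. if (u, ?vs ! j) \<in> parcs G then 1 else 0)"
    by (rule sum.reindex_bij_betw[OF bij, where g = "\<lambda>u. \<Sum>j<?n. if (u, ?vs ! j) \<in> parcs G then 1 else 0"])
  also have "\<dots> = (\<Sum>u\<in>pverts G. \<Sum>v\<in>pverts G. if (u, v) \<in> parcs G then 1 else 0)"
    by (intro sum.cong refl sum.reindex_bij_betw[OF bij])
  also have "\<dots> = (\<Sum>a\<in>pverts G \<times> pverts G. if a \<in> parcs G then 1 else 0)"
    by (simp add: sum.cartesian_product)
  also have "\<dots> = real (card (parcs G))"
  proof -
    have "parcs G \<subseteq> pverts G \<times> pverts G" using in_arcsD1 in_arcsD2 by auto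
    thus ?thesis using pair_finite_verts
      by (simp add: Int_absorb1 flip: sum.inter_restrict)
  qed
  finally show "(\<Sum>x\<leftarrow>eigenvalue_list G. x\<^sup>2) = 2 * real (num_edges G)"
    unfolding sums(2) by (simp add: card_parcs)
qed

text \<open>For even \<open>n\<close> the two (zero-based) positions are \<open>n div 2 - 1\<close> and \<open>n div 2\<close>; for odd \<open>n\<close>
  both are \<open>n div 2\<close>.\<close>

lemma HL_index_altdef:
  "HL_index G = (let n = card (pverts G) in
     max \<bar>eigenvalue_list G ! ((n + 1) div 2 - 1)\<bar> \<bar>eigenvalue_list G ! (n div 2)\<bar>)"
proof -
  have H: "nat \<lfloor>(real n + 1) / 2\<rfloor> = (n + 1) div 2" for n
    using floor_divide_of_nat_eq[of "n + 1" 2, where ?'a = real] by (simp add: add.commute)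
  have L: "nat \<lceil>(real n + 1) / 2\<rceil> = n div 2 + 1" for n
  proof (cases "even n")
    case True
    then obtain k where "n = 2 * k" by (elim evenE)
    moreover have "\<lceil>(2 * real k + 1) / 2\<rceil> = int k + 1" by (rule ceiling_unique) auto
    ultimately show ?thesis by simp
  next
    case False
    then obtain k where "n = 2 * k + 1" by (elim oddE)
    moreover have "\<lceil>(2 * real k + 2) / 2\<rceil> = int k + 1" by (rule ceiling_unique) auto
    ultimately show ?thesis by (simp add: add_ac)
  qed
  show ?thesis unfolding HL_index_def nth_eigenvalue_def Let_def H L by simp
qed

text \<open>Both median positions satisfy the index conditions of
  \<open>median_square_le_mean_square\<close>, and the mean square of the eigenvalues is exactly the
  average degree.\<close>

lemma HL_index_le_sqrt_avg_degree:
  assumes "pair_graph G" "pverts G \<noteq> {}"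
  shows "HL_index G \<le> sqrt (avg_degree G)"
proof -
  interpret pair_graph G by fact
  let ?n = "card (pverts G)" and ?xs = "eigenvalue_list G"
  have n: "?n > 0" using assms(2) pair_finite_verts by (simp add: card_gt_0_iff)
  have "\<bar>?xs ! i\<bar> \<le> sqrt (avg_degree G)" if "i < ?n" "?n \<le> 2 * Suc i" "2 * i \<le> ?n" for i
  proof -
    have "real ?n * (?xs ! i)\<^sup>2 \<le> 2 * real (num_edges G)"
      using median_square_le_mean_square[of ?xs i] that eigenvalue_list(2,3)[OF assms(1)]
        sum_eigenvalue_list[OF assms(1)] by simp
    hence "(?xs ! i)\<^sup>2 \<le> avg_degree G"
      using n by (simp add: avg_degree_def pos_le_divide_eq mult.commute)
    thus ?thesis by (simp add: real_le_rsqrt)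
  qed
  thus ?thesis unfolding HL_index_altdef Let_def using n by auto
qed

section \<open>Finite fields as residue fields\<close>

text \<open>Subring and ideal are sets in an ambient ring, and the quotient is handled through
  congruences \<open>x - y \<in> P\<close>. The ideal may be all of \<open>A\<close>; properness is
  stated separately where it is wanted.\<close>

locale subring_ideal =
  fixes A P :: "'a :: comm_ring_1 set"
  assumes one_closed: "1 \<in> A"
    and diff_closed: "x \<in> A \<Longrightarrow> y \<in> A \<Longrightarrow> x - y \<in> A"
    and mult_closed: "x \<in> A \<Longrightarrow> y \<in> A \<Longrightarrow> x * y \<in> A"
    and ideal_subset: "P \<subseteq> A"
    and ideal_zero: "0 \<in> P"
    and ideal_add: "x \<in> P \<Longrightarrow> y \<in> P \<Longrightarrow> x + y \<in> P"
    and ideal_mult: "x \<in> A \<Longrightarrow> y \<in> P \<Longrightarrow> x * y \<in> P"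
begin

lemma zero_closed: "0 \<in> A"
  using diff_closed[OF one_closed one_closed] by simp

lemma uminus_closed: "x \<in> A \<Longrightarrow> - x \<in> A"
  using diff_closed[OF zero_closed] by simp

lemma add_closed: "x \<in> A \<Longrightarrow> y \<in> A \<Longrightarrow> x + y \<in> A"
  using diff_closed[OF _ uminus_closed] by simp

lemma power_closed: "x \<in> A \<Longrightarrow> x ^ n \<in> A"
  by (induction n) (auto intro: one_closed mult_closed)

lemma of_nat_closed: "of_nat n \<in> A"
  by (induction n) (auto intro: zero_closed one_closed add_closed)

lemma of_int_closed: "of_int n \<in> A"
  by (cases n) (auto intro: of_nat_closed uminus_closed diff_closed one_closed
      simp del: of_nat_Suc)

lemmas closed = one_closed zero_closed diff_closed uminus_closed add_closed mult_closed
  power_closed of_nat_closed of_int_closed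

lemma ideal_closed: "x \<in> P \<Longrightarrow> x \<in> A"
  using ideal_subset by blast

lemma ideal_mult_right: "x \<in> P \<Longrightarrow> y \<in> A \<Longrightarrow> x * y \<in> P"
  using ideal_mult[of y x] by (simp add: mult.commute)

lemma ideal_uminus: "x \<in> P \<Longrightarrow> - x \<in> P"
  using ideal_mult[OF uminus_closed[OF one_closed]] by simp

lemma ideal_diff: "x \<in> P \<Longrightarrow> y \<in> P \<Longrightarrow> x - y \<in> P"
  using ideal_add[OF _ ideal_uminus] by simp

lemma ideal_diff_commute: "x - y \<in> P \<longleftrightarrow> y - x \<in> P"
  using ideal_uminus[of "x - y"] ideal_uminus[of "y - x"] by auto

lemma ideal_sum: "(\<And>i. i \<in> I \<Longrightarrow> f i \<in> P) \<Longrightarrow> sum f I \<in> P"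
  by (induction I rule: infinite_finite_induct) (auto intro: ideal_zero ideal_add)

lemma ideal_trans: "x - y \<in> P \<Longrightarrow> y - z \<in> P \<Longrightarrow> x - z \<in> P"
  using ideal_add[of "x - y" "y - z"] by simp

lemma ideal_cong_mult:
  assumes "x - y \<in> P" "x' - y' \<in> P" "y \<in> A" "x' \<in> A"
  shows "x * x' - y * y' \<in> P"
proof -
  have "x * x' - y * y' = (x - y) * x' + y * (x' - y')" by (simp add: algebra_simps)
  thus ?thesis using assms by (auto intro: ideal_add ideal_mult ideal_mult_right)
qed

lemma ideal_cong_power:
  assumes "x - y \<in> P" "x \<in> A" "y \<in> A"
  shows "x ^ n - y ^ n \<in> P"
  by (induction n) (use assms in \<open>auto intro: ideal_zero ideal_cong_mult power_closed\<close>)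

text \<open>Every middle binomial coefficient of a prime exponent \<open>p\<close> is a multiple of
  \<open>p\<close>, so its term lies in \<open>P\<close>.\<close>

lemma frobenius_add:
  assumes p: "prime p" "of_nat p \<in> P" and x: "x \<in> A" "y \<in> A"
  shows "(x + y) ^ p - (x ^ p + y ^ p) \<in> P"
proof -
  let ?f = "\<lambda>i. of_nat (p choose i) * x ^ i * y ^ (p - i)"
  have "p > 0" using p(1) by (simp add: prime_gt_0_nat)
  hence "{..p} = insert 0 (insert p {0<..<p})" by auto
  hence "(x + y) ^ p - (x ^ p + y ^ p) = sum ?f {0<..<p}"
    using \<open>p > 0\<close> by (simp add: binomial_ring)
  also have "\<dots> \<in> P"
  proof (rule ideal_sum)
    fix i assume i: "i \<in> {0<..<p}"
    hence "p dvd p choose i" using p(1) by (intro dvd_choose_prime) auto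
    then obtain c where "p choose i = p * c" by (elim dvdE)
    hence "?f i = of_nat p * (of_nat c * x ^ i * y ^ (p - i))" by (simp add: mult_ac)
    thus "?f i \<in> P" using p(2) x by (auto intro!: ideal_mult_right closed)
  qed
  finally show ?thesis .
qed

lemma frobenius_power_add:
  assumes p: "prime p" "of_nat p \<in> P" and x: "x \<in> A" "y \<in> A"
  shows "(x + y) ^ (p ^ k) - (x ^ (p ^ k) + y ^ (p ^ k)) \<in> P"
proof (induction k)
  case 0
  thus ?case by (simp add: ideal_zero)
next
  case (Suc k)
  let ?x = "x ^ (p ^ k)" and ?y = "y ^ (p ^ k)"
  have "((x + y) ^ (p ^ k)) ^ p - (?x + ?y) ^ p \<in> P"
    using Suc x by (auto intro: ideal_cong_power closed)
  moreover have "(?x + ?y) ^ p - (?x ^ p + ?y ^ p) \<in> P"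
    using x by (intro frobenius_add[OF p] closed)
  ultimately show ?case
    unfolding power_Suc2 power_mult by (rule ideal_trans)
qed

end

text \<open>Zorn's lemma applies to the proper ideals containing \<open>I\<close>, because the union
  of a nonempty chain is again one. Maximality is delivered in the form used later: elements outside
  \<open>M\<close> are invertible modulo \<open>M\<close>.\<close>

lemma maximal_ideal_exists:
  assumes "subring_ideal A I" "1 \<notin> I"
  obtains M where "subring_ideal A M" "I \<subseteq> M" "1 \<notin> M"
    "\<And>x. x \<in> A \<Longrightarrow> x \<notin> M \<Longrightarrow> \<exists>y\<in>A. x * y - 1 \<in> M"
proof -
  let ?F = "{J. subring_ideal A J \<and> I \<subseteq> J \<and> 1 \<notin> J}"
  have "\<exists>M\<in>?F. \<forall>X\<in>?F. M \<subseteq> X \<longrightarrow> X = M"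
  proof (rule subset_Zorn_nonempty)
    show "?F \<noteq> {}" using assms by blast
  next
    fix C assume C: "C \<noteq> {}" "subset.chain ?F C"
    hence CF: "C \<subseteq> ?F" by (simp add: subset_chain_def)
    then obtain J0 where J0: "J0 \<in> C" using C(1) by blast
    interpret J0: subring_ideal A J0 using J0 CF by auto
    have "subring_ideal A (\<Union>C)"
    proof
      show "\<Union>C \<subseteq> A" using CF by (auto simp: subring_ideal_def)
      show "0 \<in> \<Union>C" using J0 J0.ideal_zero by auto
      show "x + y \<in> \<Union>C" if xy: "x \<in> \<Union>C" "y \<in> \<Union>C" for x y
      proof -
        from xy obtain J K where JK: "J \<in> C" "K \<in> C" "x \<in> J" "y \<in> K" by auto
        hence "J \<subseteq> K \<or> K \<subseteq> J" using C(2) by (auto simp: subset_chain_def)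
        then obtain L where "L \<in> C" "x \<in> L" "y \<in> L" using JK by blast
        then interpret L: subring_ideal A L using CF by blast
        show ?thesis using \<open>L \<in> C\<close> \<open>x \<in> L\<close> \<open>y \<in> L\<close> L.ideal_add by blast
      qed
      show "x * y \<in> \<Union>C" if "x \<in> A" "y \<in> \<Union>C" for x y
      proof -
        from that obtain J where J: "J \<in> C" "y \<in> J" by blast
        then interpret J: subring_ideal A J using CF by blast
        show ?thesis using J J.ideal_mult[OF that(1)] by blast
      qed
    qed (fact J0.closed)+
    thus "\<Union>C \<in> ?F" using CF J0 by auto
  qed
  then obtain M where M': "M \<in> ?F" "\<forall>X\<in>?F. M \<subseteq> X \<longrightarrow> X = M" by (elim bexE)
  hence M: "subring_ideal A M" "I \<subseteq> M" "1 \<notin> M" by simp_all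
  have max: "X = M" if "subring_ideal A X" "1 \<notin> X" "M \<subseteq> X" for X
    using that M(2) by (intro M'(2)[rule_format]) auto
  interpret M: subring_ideal A M by fact
  have "\<exists>y\<in>A. x * y - 1 \<in> M" if x: "x \<in> A" "x \<notin> M" for x
  proof -
    \<comment> \<open>This is the ideal generated by \<open>M\<close> and \<open>x\<close>. It is
      strictly larger than \<open>M\<close>, so it must contain \<open>1\<close>, and a
      representation of \<open>1\<close> exhibits the inverse of \<open>x\<close>.\<close>
    define X where "X = {m + x * y | m y. m \<in> M \<and> y \<in> A}"
    have X_I: "m + x * y \<in> X" if "m \<in> M" "y \<in> A" for m y using that by (auto simp: X_def)
    have "m \<in> X" if "m \<in> M" for m using X_I[OF that M.zero_closed] by simp
    hence "M \<subseteq> X" by blast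
    have "x \<in> X" using X_I[OF M.ideal_zero M.one_closed] by simp
    have "subring_ideal A X"
    proof
      show "X \<subseteq> A" using x by (auto simp: X_def M.add_closed M.mult_closed M.ideal_closed)
      show "0 \<in> X" using \<open>M \<subseteq> X\<close> M.ideal_zero by auto
      show "u + v \<in> X" if uv: "u \<in> X" "v \<in> X" for u v
      proof -
        from uv obtain m y m' y' where my: "m \<in> M" "y \<in> A" "m' \<in> M" "y' \<in> A"
          and "u = m + x * y" "v = m' + x * y'" by (auto simp: X_def)
        hence "u + v = (m + m') + x * (y + y')" by (simp add: algebra_simps)
        thus ?thesis using my X_I M.ideal_add M.add_closed by simp
      qed
      show "u * v \<in> X" if uv: "u \<in> A" "v \<in> X" for u v
      proof -
        from uv obtain m y where my: "m \<in> M" "y \<in> A" and "v = m + x * y" by (auto simp: X_def)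
        hence "u * v = u * m + x * (u * y)" by (simp add: algebra_simps)
        thus ?thesis using my uv X_I M.ideal_mult M.mult_closed by simp
      qed
    qed (fact M.closed)+
    hence "1 \<in> X" using max[of X] \<open>M \<subseteq> X\<close> \<open>x \<in> X\<close> x by blast
    then obtain m y where my: "m \<in> M" "y \<in> A" "1 = m + x * y" by (auto simp: X_def)
    have "x * y - 1 = - m" by (simp add: my(3))
    thus ?thesis using my M.ideal_uminus by metis
  qed
  thus ?thesis using that M by blast
qed

section \<open>Algebraic integers and roots of unity\<close>

lemma algebraic_int_of_int_mat_eigenvalue:
  fixes x :: "'a :: field_char_0"
  assumes B: "B \<in> carrier_mat n n" and ev: "eigenvalue (map_mat of_int B) x"
  shows "algebraic_int x"
proof -
  have "poly (map_poly of_int (char_poly B)) x = 0"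
    using ev eigenvalue_root_char_poly[of "map_mat of_int B" n x] B
    by (simp add: of_int_hom.char_poly_hom[OF B])
  thus ?thesis using degree_monic_char_poly[OF B]
    unfolding algebraic_int_altdef_ipoly by auto
qed

text \<open>Multiplication by \<open>f(\<zeta>)\<close> acts on \<open>1, \<zeta>, \<dots>, \<zeta>\<^bsup>n-1\<^esup>\<close> by an integer circulant matrix.\<close>

lemma algebraic_int_poly_root_of_unity:
  fixes z :: "'a :: field_char_0"
  assumes z: "z ^ n = 1" and n: "n > 0"
  shows "algebraic_int (poly (of_int_poly f) z)"
proof -
  let ?x = "poly (of_int_poly f) z"
  define B where "B = mat n n (\<lambda>(i, j). \<Sum>k | k \<le> degree f \<and> (k + i) mod n = j. coeff f k)"
  define v where "v = vec n (\<lambda>j. z ^ j)"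
  have B: "B \<in> carrier_mat n n" by (simp add: B_def)
  have zmod: "z ^ (m mod n) = z ^ m" for m
  proof -
    have "z ^ m = z ^ (n * (m div n) + m mod n)" by simp
    also have "\<dots> = z ^ (m mod n)" unfolding power_add power_mult z by simp
    finally show ?thesis ..
  qed
  have "map_mat of_int B *\<^sub>v v = ?x \<cdot>\<^sub>v v"
  proof (rule eq_vecI)
    fix i assume "i < dim_vec (?x \<cdot>\<^sub>v v)"
    hence i: "i < n" by (simp add: v_def)
    have "(map_mat of_int B *\<^sub>v v) $ i =
        (\<Sum>j<n. \<Sum>k | k \<le> degree f \<and> (k + i) mod n = j. of_int (coeff f k) * z ^ j)"
      using i by (auto simp: B_def v_def scalar_prod_def lessThan_atLeast0 sum_distrib_right
          intro!: sum.cong)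
    also have "\<dots> = (\<Sum>j<n. \<Sum>k | k \<in> {..degree f} \<and> (k + i) mod n = j. of_int (coeff f k) * z ^ (k + i))"
      by (intro sum.cong) (auto simp flip: zmod[of "_ + i"])
    \<comment> \<open>The exponents \<open>k\<close> are partitioned by the residue of
      \<open>k + i\<close> modulo \<open>n\<close>, one class for each column
      \<open>j\<close>.\<close>
    also have "\<dots> = (\<Sum>k\<le>degree f. of_int (coeff f k) * z ^ (k + i))"
      using n by (intro sum.group) auto
    also have "\<dots> = ?x * z ^ i"
      by (simp add: poly_altdef sum_distrib_right power_add mult.assoc)
    finally show "(map_mat of_int B *\<^sub>v v) $ i = (?x \<cdot>\<^sub>v v) $ i" using i by (simp add: v_def)
  qed (simp add: B_def v_def)
  moreover have "v \<noteq> 0\<^sub>v n"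
  proof
    assume "v = 0\<^sub>v n"
    hence "v $ 0 = 0" using n by simp
    thus False using n by (simp add: v_def)
  qed
  ultimately have "eigenvalue (map_mat of_int B) ?x"
    unfolding eigenvalue_def eigenvector_def by (intro exI[of _ v]) (simp add: B_def v_def)
  thus ?thesis by (rule algebraic_int_of_int_mat_eigenvalue[OF B])
qed

text \<open>Both sides, read as polynomials in \<open>x\<close>, are monic of degree
  \<open>n\<close> and vanish at the \<open>n\<close> powers of \<open>z\<close>, which are distinct
  by primitivity.\<close>

lemma prod_linear_roots_of_unity:
  fixes z :: "'a :: idom"
  assumes z: "z ^ n = 1" and n: "n > 0" and prim: "\<And>i. 0 < i \<Longrightarrow> i < n \<Longrightarrow> z ^ i \<noteq> 1"
  shows "x ^ n - 1 = (\<Prod>i<n. x - z ^ i)"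
proof -
  have z0: "z \<noteq> 0" using z n by (auto simp: power_0_left)
  have inj: "inj_on (\<lambda>i. z ^ i) {..<n}"
  proof (rule linorder_inj_onI')
    fix i j assume ij: "i \<in> {..<n}" "j \<in> {..<n}" "i < j"
    have "z ^ j = z ^ i * z ^ (j - i)" using ij by (simp flip: power_add)
    thus "z ^ i \<noteq> z ^ j" using prim[of "j - i"] ij z0 by auto
  qed
  let ?P = "\<Prod>i<n. [:- (z ^ i), 1:]" and ?Q = "monom 1 n - 1 :: 'a poly"
  have degP: "degree ?P = n" by (subst degree_prod_eq_sum_degree) auto
  have degQ: "degree ?Q = n" using n degree_add_eq_left[of "- 1" "monom 1 n :: 'a poly"]
    by (simp add: degree_monom_eq)
  have "?P = ?Q"
  proof (rule poly_eqI_degree_lead_coeff[where A = "(\<lambda>i. z ^ i) ` {..<n}" and n = n])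
    show "poly ?P y = poly ?Q y" if y: "y \<in> (\<lambda>i. z ^ i) ` {..<n}" for y
    proof -
      obtain i where i: "i < n" "y = z ^ i" using y by auto
      have "y ^ n = 1" using z by (simp add: i flip: power_mult) (metis mult.commute power_mult power_one)
      thus ?thesis using i by (auto simp: poly_prod poly_monom intro!: prod_zero)
    qed
    show "coeff ?P n = coeff ?Q n"
    proof -
      have "monic ?P" by (rule monic_prod) auto
      thus ?thesis using n degP by (simp add: coeff_diff)
    qed
  qed (use degP degQ inj in \<open>auto simp: card_image\<close>)
  hence "poly ?P x = poly ?Q x" by simp
  thus ?thesis by (simp add: poly_prod poly_monom)
qed

text \<open>The finite field \<open>A / P\<close> is represented by a transversal \<open>S\<close>:
  field elements stay elements of the ambient ring, and field equations become congruences modulo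
  \<open>P\<close>.\<close>

locale residue_field = subring_ideal A P for A P :: "'a :: comm_ring_1 set" +
  fixes S :: "'a set"
  assumes proper: "1 \<notin> P"
    and inverse_mod: "x \<in> A \<Longrightarrow> x \<notin> P \<Longrightarrow> \<exists>y\<in>A. x * y - 1 \<in> P"
    and residues_closed: "S \<subseteq> A"
    and finite_residues: "finite S"
    and ex1_residue: "x \<in> A \<Longrightarrow> \<exists>!s. s \<in> S \<and> x - s \<in> P"

text \<open>If \<open>y\<close> has an inverse \<open>w\<close> modulo \<open>P\<close>, then
  \<open>x\<close> is congruent to \<open>w * (x * y)\<close>.\<close>

lemma (in subring_ideal) prime_if_inverse_mod:
  assumes inv: "\<And>x. x \<in> A \<Longrightarrow> x \<notin> P \<Longrightarrow> \<exists>y\<in>A. x * y - 1 \<in> P"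
    and xy: "x \<in> A" "y \<in> A" "x * y \<in> P"
  shows "x \<in> P \<or> y \<in> P"
proof (rule disjCI)
  assume "y \<notin> P"
  then obtain w where w: "w \<in> A" "y * w - 1 \<in> P" using inv xy by blast
  have "x = w * (x * y) - (y * w - 1) * x" by (simp add: algebra_simps)
  thus "x \<in> P" using w xy ideal_diff[OF ideal_mult ideal_mult_right] by metis
qed

text \<open>Every element of \<open>A\<close> is fixed modulo \<open>P\<close> by the
  \<open>q\<close>-th power map. Hence \<open>x * (x ^ n - 1)\<close>, which is \<open>x\<close>
  times the product of all \<open>x - z ^ i\<close>, lies in the prime ideal \<open>P\<close>, so
  \<open>x\<close> is congruent to \<open>0\<close> or to a power of \<open>z\<close>. These
  \<open>q\<close> residues are pairwise incongruent because \<open>n = q - 1\<close> is nonzero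
  modulo \<open>P\<close>.\<close>

theorem residue_field_exists:
  assumes p: "prime (p :: nat)" and k: "k \<ge> 1"
  obtains A P S :: "complex set" where "residue_field A P S" "card S = p ^ k"
proof -
  define q where "q = p ^ k"
  define n where "n = q - 1"
  have "p > 1" using p by (rule prime_gt_1_nat)
  hence q1: "q > 1" using k unfolding q_def by (intro one_less_power) auto
  hence n: "n > 0" "q = Suc n" by (simp_all add: n_def)
  define z where "z = cis (2 * pi / n)"
  have z: "z ^ n = 1" using n by (simp add: z_def DeMoivre)
  have prim: "z ^ i \<noteq> 1" if i: "0 < i" "i < n" for i
  proof
    assume "z ^ i = 1"
    hence "cis (2 * pi * real i / real n) = cis (2 * pi * real 0 / real n)"
      by (simp add: z_def DeMoivre mult_ac)
    moreover have "inj_on (\<lambda>i. cis (2 * pi * real i / real n)) {..<n}"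
      using bij_betw_roots_unity[OF n(1)] by (simp add: bij_betw_def)
    ultimately have "i = 0" using i n by (auto dest!: inj_onD[where x = i and y = 0])
    thus False using i by simp
  qed
  define A where "A = range (\<lambda>f. poly (of_int_poly f) z)"
  have A_one: "1 \<in> A" unfolding A_def by (rule range_eqI[of _ _ 1]) simp
  have A_diff: "x - y \<in> A" if "x \<in> A" "y \<in> A" for x y
  proof -
    from that obtain f g where "x = poly (of_int_poly f) z" "y = poly (of_int_poly g) z"
      by (auto simp: A_def)
    thus ?thesis unfolding A_def by (intro range_eqI[of _ _ "f - g"]) (simp add: of_int_poly_hom.hom_minus)
  qed
  have A_mult: "x * y \<in> A" if "x \<in> A" "y \<in> A" for x y
  proof -
    from that obtain f g where "x = poly (of_int_poly f) z" "y = poly (of_int_poly g) z"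
      by (auto simp: A_def)
    thus ?thesis unfolding A_def by (intro range_eqI[of _ _ "f * g"]) (simp add: of_int_poly_hom.hom_mult)
  qed
  have zA: "z \<in> A" unfolding A_def by (rule range_eqI[of _ _ "[:0, 1:]"]) simp
  \<comment> \<open>Taking the unit ideal gives the closure facts of the ring before a proper ideal
    is at hand.\<close>
  interpret A: subring_ideal A A
    by standard (use A_one A_diff A_mult A_diff[OF A_one A_one]
        A_diff[OF _ A_diff[OF A_diff[OF A_one A_one]]] in auto)
  let ?I = "(\<lambda>x. of_nat p * x) ` A"
  have "subring_ideal A ?I"
  proof
    show "0 \<in> ?I" using A.zero_closed by force
    show "x + y \<in> ?I" if "x \<in> ?I" "y \<in> ?I" for x y
      using that A.add_closed by (auto simp flip: distrib_left)
    show "x * y \<in> ?I" if "x \<in> A" "y \<in> ?I" for x y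
      using that A_mult by (auto simp: mult.left_commute)
  qed (auto intro: A.closed)
  \<comment> \<open>Otherwise \<open>1 / p\<close> would lie in \<open>A\<close>; being a rational
    algebraic integer, it would be an integer.\<close>
  moreover have "1 \<notin> ?I"
  proof
    assume "1 \<in> ?I"
    then obtain x where x: "x \<in> A" "1 = of_nat p * x" by blast
    have "algebraic_int x" using x(1) algebraic_int_poly_root_of_unity[OF z n(1)] by (auto simp: A_def)
    moreover have xp: "x = 1 / of_nat p" using x(2) \<open>p > 1\<close> by (simp add: field_simps)
    hence "x \<in> \<rat>" by simp
    ultimately have "x \<in> \<int>" by (rule rational_algebraic_int_is_int)
    then obtain m where "x = of_int m" by (elim Ints_cases)
    hence "of_int 1 = (of_int (int p * m) :: complex)" using x(2) by simp
    hence "1 = int p * m" by (simp only: of_int_eq_iff)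
    hence "int p dvd 1" by (intro dvdI)
    thus False using \<open>p > 1\<close> by simp
  qed
  ultimately obtain P where P: "subring_ideal A P" "?I \<subseteq> P" "1 \<notin> P"
    and inv: "\<And>x. x \<in> A \<Longrightarrow> x \<notin> P \<Longrightarrow> \<exists>y\<in>A. x * y - 1 \<in> P"
    by (rule maximal_ideal_exists) blast
  interpret subring_ideal A P by fact
  note prime = prime_if_inverse_mod[OF inv]
  have pP: "of_nat p \<in> P" using P(2) one_closed by force
  have qP: "of_nat q \<in> P" unfolding q_def of_nat_power
    using k pP by (cases k) (auto intro!: ideal_mult_right closed)
  have q0: "q > 0" using q1 by simp
  let ?Fix = "\<lambda>x. x ^ q - x \<in> P"
  have Fix_add: "?Fix (x + y)" if "x \<in> A" "y \<in> A" "?Fix x" "?Fix y" for x y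
  proof -
    have "(x + y) ^ q - (x + y) = ((x + y) ^ q - (x ^ q + y ^ q)) + ((x ^ q - x) + (y ^ q - y))"
      by simp
    also have "\<dots> \<in> P"
      using that frobenius_power_add[OF p pP, of x y k] by (intro ideal_add) (simp_all add: q_def)
    finally show ?thesis .
  qed
  have Fix_ideal: "?Fix x" if "x \<in> P" for x
  proof -
    have "x ^ q - x = x * (x ^ n - 1)" by (simp add: n(2) algebra_simps)
    also have "\<dots> \<in> P" by (intro ideal_mult_right closed ideal_closed that)
    finally show ?thesis .
  qed
  have Fix_nat: "?Fix (of_nat m)" for m
  proof (induction m)
    case 0
    thus ?case using q0 by (simp add: ideal_zero power_0_left)
  next
    case (Suc m)
    thus ?case using Fix_add[of "of_nat m" 1] by (simp add: closed ideal_zero add.commute)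
  qed
  have Fix_int: "?Fix (of_int m)" for m
  proof -
    \<comment> \<open>Modulo \<open>P\<close> an integer may be replaced by its natural remainder
      modulo \<open>p\<close>, for which \<open>Fix_nat\<close> applies.\<close>
    have "m = int (nat (m mod int p)) + int p * (m div int p)" using \<open>p > 1\<close> by simp
    hence m: "of_int m = (of_nat (nat (m mod int p)) + of_nat p * of_int (m div int p) :: complex)"
      by (metis of_int_add of_int_mult of_int_of_nat_eq)
    show ?thesis unfolding m
      by (intro Fix_add Fix_nat Fix_ideal ideal_mult_right pP closed)
  qed
  have Fix: "?Fix x" if "x \<in> A" for x
  proof -
    have "?Fix (poly (of_int_poly f) z)" for f
    \<comment> \<open>Horner's scheme: the fixed elements are closed under addition, contain the
      integers, and are closed under multiplication by \<open>z\<close> because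
      \<open>z ^ q = z\<close>.\<close>
    proof (induction f rule: pCons_induct)
      case 0
      thus ?case using q0 by (simp add: ideal_zero power_0_left)
    next
      case (pCons a f)
      let ?y = "poly (of_int_poly f) z"
      have y: "?y \<in> A" by (auto simp: A_def)
      have "(z * ?y) ^ q - z * ?y = z * (?y ^ q - ?y)"
        using z by (simp add: n(2) power_mult_distrib algebra_simps)
      hence "?Fix (z * ?y)" using pCons.IH zA by (auto intro: ideal_mult)
      hence "?Fix (of_int a + z * ?y)" using y zA by (intro Fix_add Fix_int closed) auto
      thus ?case by (simp only: of_int_hom.map_poly_pCons_hom poly_pCons)
    qed
    moreover from that obtain f where "x = poly (of_int_poly f) z" by (auto simp: A_def)
    ultimately show ?thesis by simp
  qed
  have nP: "of_nat n \<notin> P"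
  proof
    assume "of_nat n \<in> P"
    hence "of_nat q - of_nat n \<in> P" using qP by (intro ideal_diff)
    thus False using P(3) n(2) by simp
  qed
  have z_notin: "z ^ i \<notin> P" if "i < n" for i
  proof
    assume "z ^ i \<in> P"
    hence "z ^ i * z ^ (n - i) \<in> P" using zA by (intro ideal_mult_right closed)
    thus False using that z P(3) by (simp flip: power_add)
  qed
  have z_diff_notin: "z ^ j - z ^ i \<notin> P" if ij: "i < j" "j < n" for i j
  proof
    assume "z ^ j - z ^ i \<in> P"
    moreover define w where "w = z ^ (j - i)"
    have "z ^ j = z ^ i * w" using ij by (simp add: w_def flip: power_add)
    ultimately have "z ^ i * (w - 1) \<in> P" by (simp add: algebra_simps)
    hence w1: "w - 1 \<in> P" using prime[of "z ^ i" "w - 1"] z_notin[of i] ij zA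
      by (auto simp: w_def intro: closed)
    have wA: "w \<in> A" using zA by (auto simp: w_def intro: closed)
    have "w \<noteq> 1" unfolding w_def using prim ij by simp
    moreover have "w ^ n = 1" using z by (simp add: w_def flip: power_mult) (metis mult.commute power_mult power_one)
    \<comment> \<open>The geometric sum vanishes as \<open>w\<close> is an \<open>n\<close>-th root
      of unity other than \<open>1\<close>. If \<open>w\<close> were congruent to \<open>1\<close>,
      the sum would also be congruent to \<open>n\<close>, which is not in \<open>P\<close>.\<close>
    ultimately have "(\<Sum>l<n. w ^ l) = 0" by (simp add: geometric_sum)
    moreover have "(\<Sum>l<n. w ^ l - 1 ^ l) \<in> P"
      by (intro ideal_sum ideal_cong_power w1 wA closed)
    ultimately have "- of_nat n \<in> P" by (simp add: sum_subtractf)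
    thus False using nP ideal_uminus by fastforce
  qed
  define S where "S = insert 0 ((\<lambda>i. z ^ i) ` {..<n})"
  have S_eq: "s = t" if "s \<in> S" "t \<in> S" "s - t \<in> P" for s t
  proof -
    have "i = j" if "i < n" "j < n" "z ^ i - z ^ j \<in> P" for i j
      using that z_diff_notin[of i j] z_diff_notin[of j i]
      by (cases i j rule: linorder_cases) (auto simp: ideal_diff_commute)
    moreover have "- (z ^ i) \<notin> P" if "i < n" for i
      using z_notin[OF that] ideal_uminus[of "- (z ^ i)"] by auto
    ultimately show ?thesis using that z_notin by (auto simp: S_def)
  qed
  have SA: "S \<subseteq> A" using zA by (auto simp: S_def intro: closed)
  have "inj_on (\<lambda>i. z ^ i) {..<n}"
    by (rule linorder_inj_onI') (use z_diff_notin ideal_zero in fastforce)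
  moreover have "0 \<notin> (\<lambda>i. z ^ i) ` {..<n}" using z_notin ideal_zero by (metis imageE lessThan_iff)
  ultimately have "card S = q" by (simp add: S_def card_image n)
  moreover have "residue_field A P S"
  proof
    show "1 \<notin> P" "S \<subseteq> A" "finite S" using P(3) SA by (auto simp: S_def)
    show "\<exists>y\<in>A. x * y - 1 \<in> P" if "x \<in> A" "x \<notin> P" for x using inv that by blast
    show "\<exists>!s. s \<in> S \<and> x - s \<in> P" if x: "x \<in> A" for x
    proof (rule ex_ex1I)
      show "\<exists>s. s \<in> S \<and> x - s \<in> P"
      proof (cases "x \<in> P")
        case True
        thus ?thesis by (intro exI[of _ 0]) (simp add: S_def)
      next
        case False
        have "x * (x ^ n - 1) \<in> P" using Fix[OF x] by (simp add: n algebra_simps)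
        hence "x ^ n - 1 \<in> P" using prime[of x "x ^ n - 1"] False x by (auto intro: closed)
        hence "(\<Prod>i<n. x - z ^ i) \<in> P" using prod_linear_roots_of_unity[OF z n(1) prim] by simp
        \<comment> \<open>Primality is applied factor by factor, by induction on the number of
          factors.\<close>
        moreover have "\<exists>i<m. x - z ^ i \<in> P" if "(\<Prod>i<m. x - z ^ i) \<in> P" for m
          using that
        proof (induction m)
          case 0
          thus ?case using P(3) by simp
        next
          case (Suc m)
          have "(\<Prod>i<m. x - z ^ i) \<in> A" by (induction m) (use x zA in \<open>auto intro!: closed\<close>)
          hence "(\<Prod>i<m. x - z ^ i) \<in> P \<or> x - z ^ m \<in> P"
            using Suc.prems x zA by (intro prime) (auto intro!: closed)
          thus ?case using Suc.IH less_Suc_eq by auto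
        qed
        ultimately show ?thesis by (auto simp: S_def)
      qed
      show "s = t" if "s \<in> S \<and> x - s \<in> P" "t \<in> S \<and> x - t \<in> P" for s t
        using that S_eq[of s t] ideal_diff[of "x - t" "x - s"] by simp
    qed
  qed
  ultimately show ?thesis using that by (simp add: q_def)
qed

section \<open>A projective plane with a polarity\<close>

text \<open>Besides the affine points there is one point at infinity \<open>Dir m\<close> per direction, and the
  vertical one, \<open>Vert\<close>. The same type names the lines: \<open>Aff m b\<close> is \<open>y = m x - b\<close>, \<open>Dir x\<close>
  is a vertical line and \<open>Vert\<close> the line at infinity. The sign of \<open>b\<close> makes incidence symmetric,
  so that the identification of points with lines is a polarity.\<close>

datatype 'a point = Aff 'a 'a | Dir 'a | Vert

context residue_field
begin

text \<open>Only the affine clause needs a congruence; elsewhere coordinates are compared by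
  equality, which agrees with congruence on the transversal \<open>S\<close>.\<close>

fun incident :: "'a point \<Rightarrow> 'a point \<Rightarrow> bool" where
  "incident (Aff x y) (Aff m b) \<longleftrightarrow> x * m - y - b \<in> P"
| "incident (Aff x y) (Dir z) \<longleftrightarrow> x = z"
| "incident (Dir z) (Aff x y) \<longleftrightarrow> x = z"
| "incident (Dir z) Vert \<longleftrightarrow> True"
| "incident Vert (Dir z) \<longleftrightarrow> True"
| "incident Vert Vert \<longleftrightarrow> True"
| "incident _ _ \<longleftrightarrow> False"

definition points :: "'a point set" where
  "points = (\<lambda>(x, y). Aff x y) ` (S \<times> S) \<union> Dir ` S \<union> {Vert}"

lemma points_iff [simp]:
  "Aff x y \<in> points \<longleftrightarrow> x \<in> S \<and> y \<in> S" "Dir x \<in> points \<longleftrightarrow> x \<in> S" "Vert \<in> points"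
  by (auto simp: points_def)

lemma finite_points: "finite points"
  using finite_residues by (simp add: points_def)

lemma incident_commute: "incident u v \<longleftrightarrow> incident v u"
  by (cases u; cases v) (auto simp: algebra_simps)

definition residue :: "'a \<Rightarrow> 'a" where
  "residue x = (THE s. s \<in> S \<and> x - s \<in> P)"

lemma residue: "x \<in> A \<Longrightarrow> residue x \<in> S" "x \<in> A \<Longrightarrow> x - residue x \<in> P"
  using theI'[OF ex1_residue[of x]] by (auto simp: residue_def)

lemma residue_unique: "x \<in> A \<Longrightarrow> s \<in> S \<Longrightarrow> x - s \<in> P \<longleftrightarrow> s = residue x"
  using ex1_residue residue by blast

lemma residue_closed: "s \<in> S \<Longrightarrow> s \<in> A"
  using residues_closed by blast

lemma residues_eq: "s \<in> S \<Longrightarrow> t \<in> S \<Longrightarrow> s - t \<in> P \<Longrightarrow> s = t"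
  using residue_unique[of s s] residue_unique[of s t] by (simp add: residue_closed ideal_zero)

text \<open>Through an affine point there is one line for each slope in \<open>S\<close>, its
  intercept being forced, and one vertical line. A point at infinity lies on one parallel class of
  \<open>card S\<close> affine lines and on the line at infinity.\<close>

lemma card_incident:
  assumes "u \<in> points"
  shows "card {v \<in> points. incident u v} = card S + 1"
proof (cases u)
  case (Aff x y)
  let ?f = "\<lambda>m. Aff m (residue (x * m - y))"
  have xy: "x \<in> S" "y \<in> S" using assms Aff by auto
  have "{v \<in> points. incident u v} = insert (Dir x) (?f ` S)"
  proof (intro equalityI subsetI)
    fix v assume "v \<in> {v \<in> points. incident u v}"
    thus "v \<in> insert (Dir x) (?f ` S)"
      using xy Aff by (cases v) (auto simp: residue_unique residue_closed closed)
  qed (use xy Aff in \<open>auto simp: residue residue_closed closed\<close>)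
  moreover have "inj_on ?f S" by (auto simp: inj_on_def)
  moreover have "Dir x \<notin> ?f ` S" by auto
  ultimately show ?thesis by (simp add: card_image finite_residues)
next
  case (Dir m)
  have "{v \<in> points. incident u v} = insert Vert (Aff m ` S)"
  proof (intro equalityI subsetI)
    fix v assume "v \<in> {v \<in> points. incident u v}"
    thus "v \<in> insert Vert (Aff m ` S)" using Dir by (cases v) auto
  qed (use assms Dir in auto)
  moreover have "inj_on (Aff m) S" by (auto simp: inj_on_def)
  moreover have "Vert \<notin> Aff m ` S" by auto
  ultimately show ?thesis by (simp add: card_image finite_residues)
next
  case Vert
  have "{v \<in> points. incident u v} = insert Vert (Dir ` S)"
  proof (intro equalityI subsetI)
    fix v assume "v \<in> {v \<in> points. incident u v}"
    thus "v \<in> insert Vert (Dir ` S)" using Vert by (cases v) auto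
  qed (use Vert in auto)
  moreover have "inj_on Dir S" by (auto simp: inj_on_def)
  moreover have "Vert \<notin> Dir ` S" by auto
  ultimately show ?thesis by (simp add: card_image finite_residues)
qed

text \<open>Subtracting the two incidence congruences leaves \<open>(x - x') * m\<close> congruent
  to \<open>y - y'\<close>. Distinct representatives differ by a unit modulo \<open>P\<close>, so
  the slope is determined, and then the intercept.\<close>

lemma ex1_line_through_affine_points:
  assumes S: "x \<in> S" "y \<in> S" "x' \<in> S" "y' \<in> S" and neq: "x \<noteq> x'"
  shows "\<exists>m\<in>S. \<exists>b\<in>S. \<forall>m'\<in>S. \<forall>b'\<in>S.
    (x * m' - y - b' \<in> P \<and> x' * m' - y' - b' \<in> P \<longleftrightarrow> m' = m \<and> b' = b)"
proof -
  note [intro] = residue_closed[OF S(1)] residue_closed[OF S(2)] residue_closed[OF S(3)]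
    residue_closed[OF S(4)] closed
  have "x - x' \<notin> P" using neq residues_eq[OF S(1,3)] by blast
  then obtain z where z: "z \<in> A" "(x - x') * z - 1 \<in> P" using inverse_mod[of "x - x'"] by blast
  define m where "m = residue (z * (y - y'))"
  have "z * (y - y') \<in> A" using z(1) by blast
  hence m: "m \<in> S" "z * (y - y') - m \<in> P" unfolding m_def by (auto intro!: residue)
  have mA: "m \<in> A" using m residue_closed by blast
  have solves: "(x - x') * m' - (y - y') \<in> P \<longleftrightarrow> m' = m" if m': "m' \<in> S" for m'
  proof -
    have m'A: "m' \<in> A" using m' residue_closed by blast
    have "(x - x') * m' - (y - y') \<in> P \<longleftrightarrow> z * (y - y') - m' \<in> P"
    proof
      assume *: "(x - x') * m' - (y - y') \<in> P"
      have "z * (y - y') - m' = ((x - x') * z - 1) * m' - z * ((x - x') * m' - (y - y'))"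
        by (simp add: algebra_simps)
      also have "\<dots> \<in> P" by (rule ideal_diff[OF ideal_mult_right[OF z(2) m'A] ideal_mult[OF z(1) *]])
      finally show "z * (y - y') - m' \<in> P" .
    next
      assume *: "z * (y - y') - m' \<in> P"
      have "(x - x') * m' - (y - y') =
          ((x - x') * z - 1) * (y - y') - (x - x') * (z * (y - y') - m')"
        by (simp add: algebra_simps)
      also have "\<dots> \<in> P" by (rule ideal_diff[OF ideal_mult_right[OF z(2)] ideal_mult[OF _ *]]) blast+
      finally show "(x - x') * m' - (y - y') \<in> P" .
    qed
    also have "\<dots> \<longleftrightarrow> m' = m"
      unfolding m_def using z m' by (intro residue_unique) blast+
    finally show ?thesis .
  qed
  have "x * m' - y - b' \<in> P \<and> x' * m' - y' - b' \<in> P \<longleftrightarrow> m' = m \<and> b' = residue (x * m - y)"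
    if mb: "m' \<in> S" "b' \<in> S" for m' b'
  proof -
    have "x' * m' - y' - b' \<in> P \<longleftrightarrow> (x - x') * m' - (y - y') \<in> P" if "x * m' - y - b' \<in> P"
    proof -
      have e: "(x - x') * m' - (y - y') = (x * m' - y - b') - (x' * m' - y' - b')"
        "x' * m' - y' - b' = (x * m' - y - b') - ((x - x') * m' - (y - y'))"
        by (simp_all add: algebra_simps)
      show ?thesis using that ideal_diff e by metis
    qed
    moreover have "x * m' - y - b' \<in> P \<longleftrightarrow> b' = residue (x * m' - y)"
      using mb residue_closed[OF mb(1)] by (intro residue_unique) blast+
    ultimately show ?thesis using solves[OF mb(1)] by blast
  qed
  moreover have "residue (x * m - y) \<in> S" using mA by (intro residue) blast
  ultimately show ?thesis using m(1) by blast
qed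

text \<open>The unique common line is found by cases on the kinds of the two points; symmetry in the
  pair halves the cases.\<close>

lemma card_common_incident:
  assumes "u \<in> points" "v \<in> points" "u \<noteq> v"
  shows "card {w \<in> points. incident u w \<and> incident v w} = 1"
proof -
  note S = residue residue_closed closed
  have "\<exists>w\<in>points. \<forall>w'\<in>points. incident u w' \<and> incident v w' \<longleftrightarrow> w' = w" (is "?Q u v")
  proof -
    have sym: "?Q u v" if "?Q v u" for u v using that by meson
    have AA: "?Q (Aff x y) (Aff x' y')"
      if h: "x \<in> S" "y \<in> S" "x' \<in> S" "y' \<in> S" "Aff x y \<noteq> Aff x' y'" for x y x' y'
    proof (cases "x = x'")
      case True
      have "w' = Dir x" if w': "w' \<in> points" "incident (Aff x y) w'" "incident (Aff x' y') w'" for w'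
      proof (cases w')
        case (Aff m b)
        \<comment> \<open>A nonvertical line through both points would force them to coincide when
          their first coordinates agree.\<close>
        have "y' - y = (x * m - y - b) - (x' * m - y' - b)" using True by simp
        also have "\<dots> \<in> P" using ideal_diff[of "x * m - y - b" "x' * m - y' - b"] w' Aff by simp
        finally have "y' = y" using h residues_eq by blast
        thus ?thesis using h True by simp
      qed (use w' in auto)
      thus ?thesis using h True by (intro bexI[of _ "Dir x"]) auto
    next
      case False
      then obtain m b where mb: "\<And>m' b'. m' \<in> S \<Longrightarrow> b' \<in> S \<Longrightarrow>
        (x * m' - y - b' \<in> P \<and> x' * m' - y' - b' \<in> P) = (m' = m \<and> b' = b)" and "m \<in> S" "b \<in> S"
        using ex1_line_through_affine_points[OF h(1-4) False] by metis
      show ?thesis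
      proof (intro bexI[of _ "Aff m b"] ballI)
        fix w' assume "w' \<in> points"
        thus "incident (Aff x y) w' \<and> incident (Aff x' y') w' \<longleftrightarrow> w' = Aff m b"
          using mb \<open>x \<noteq> x'\<close> by (cases w') auto
      qed (use \<open>m \<in> S\<close> \<open>b \<in> S\<close> in simp)
    qed
    have AI: "?Q (Aff x y) (Dir m)" if h: "x \<in> S" "y \<in> S" "m \<in> S" for x y m
    proof (intro bexI[of _ "Aff m (residue (x * m - y))"] ballI)
      fix w' assume "w' \<in> points"
      thus "incident (Aff x y) w' \<and> incident (Dir m) w' \<longleftrightarrow> w' = Aff m (residue (x * m - y))"
        using h by (cases w') (auto simp: residue_unique S)
    qed (use h in \<open>simp add: S\<close>)
    have AT: "?Q (Aff x y) Vert" if h: "x \<in> S" "y \<in> S" for x y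
    proof (intro bexI[of _ "Dir x"] ballI)
      fix w' assume "w' \<in> points"
      thus "incident (Aff x y) w' \<and> incident Vert w' \<longleftrightarrow> w' = Dir x" using h by (cases w') auto
    qed (use h in simp)
    have II: "?Q (Dir m) (Dir m')" if h: "m \<noteq> m'" for m m'
    proof (intro bexI[of _ Vert] ballI)
      fix w' assume "w' \<in> points"
      thus "incident (Dir m) w' \<and> incident (Dir m') w' \<longleftrightarrow> w' = Vert" using h by (cases w') auto
    qed simp
    have IT: "?Q (Dir m) Vert" for m
    proof (intro bexI[of _ Vert] ballI)
      fix w' assume "w' \<in> points"
      thus "incident (Dir m) w' \<and> incident Vert w' \<longleftrightarrow> w' = Vert" by (cases w') auto
    qed simp
    show ?thesis
      using assms by (cases u; cases v) (simp_all add: AA AI AT II IT sym[OF AI] sym[OF AT] sym[OF IT])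
  qed
  then obtain w where "w \<in> points" "\<And>w'. w' \<in> points \<Longrightarrow> incident u w' \<and> incident v w' \<longleftrightarrow> w' = w"
    by blast
  hence "{w \<in> points. incident u w \<and> incident v w} = {w}" by blast
  thus ?thesis by simp
qed

end

text \<open>The plane is transported along an enumeration of its points, since the suprema range
  over graphs on natural numbers. Only symmetry, degree and codegree of the incidence relation are
  kept.\<close>

lemma polarity_exists:
  assumes "prime p" "k \<ge> 1"
  shows "\<exists>(N :: nat) I. N > 0 \<and> (\<forall>i j. I i j \<longleftrightarrow> I j i) \<and>
    (\<forall>i<N. card {j. j < N \<and> I i j} = p ^ k + 1) \<and>
    (\<forall>i<N. \<forall>j<N. i \<noteq> j \<longrightarrow> card {l. l < N \<and> I i l \<and> I j l} = 1)"
proof -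
  obtain A P S :: "complex set" where "residue_field A P S" and S: "card S = p ^ k"
    using residue_field_exists[OF assms] .
  interpret residue_field A P S by fact
  obtain h where h: "bij_betw h {0..<card points} points"
    using ex_bij_betw_nat_finite[OF finite_points] by blast
  have inj: "inj_on h {0..<card points}" and img: "h ` {0..<card points} = points"
    using h by (auto simp: bij_betw_def)
  have transfer: "card {j. j < card points \<and> Q (h j)} = card {w \<in> points. Q w}" for Q
  proof -
    have "{w \<in> points. Q w} = h ` {j. j < card points \<and> Q (h j)}" using img by force
    moreover have "inj_on h {j. j < card points \<and> Q (h j)}" using inj by (auto simp: inj_on_def)
    ultimately show ?thesis by (simp add: card_image)
  qed
  have mem: "h i \<in> points" if "i < card points" for i using that img by auto
  show ?thesis
  proof (rule exI[of _ "card points"], rule exI[of _ "\<lambda>i j. incident (h i) (h j)"],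
      intro conjI allI impI)
    show "card points > 0" using finite_points points_iff(3) card_gt_0_iff by blast
    show "incident (h i) (h j) \<longleftrightarrow> incident (h j) (h i)" for i j by (rule incident_commute)
    show "card {j. j < card points \<and> incident (h i) (h j)} = p ^ k + 1" if "i < card points" for i
      using transfer[of "incident (h i)"] card_incident[OF mem[OF that]] S by simp
    show "card {l. l < card points \<and> incident (h i) (h l) \<and> incident (h j) (h l)} = 1"
      if "i < card points" "j < card points" "i \<noteq> j" for i j
    proof -
      have "h i \<noteq> h j" using inj that by (auto simp: inj_on_def)
      thus ?thesis
        using transfer[of "\<lambda>w. incident (h i) w \<and> incident (h j) w"] card_common_incident mem that
        by simp
    qed
  qed
qed

section \<open>The bipartite double of a polarity\<close>

text \<open>With \<open>M\<close> the incidence matrix of \<open>I\<close>, the left side is the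
  squared norm of the transpose of \<open>M\<close> applied to \<open>u\<close>. Expanding it gives
  the quadratic form of \<open>q I + J\<close>: the diagonal entries are \<open>q + 1\<close>, all
  others \<open>1\<close>.\<close>

lemma sum_squares_incidence:
  fixes u :: "nat \<Rightarrow> real"
  assumes deg: "\<And>j. j < N \<Longrightarrow> card {i. i < N \<and> I j i} = q + 1"
    and codeg: "\<And>j l. j < N \<Longrightarrow> l < N \<Longrightarrow> j \<noteq> l \<Longrightarrow> card {i. i < N \<and> I j i \<and> I l i} = 1"
  shows "(\<Sum>i<N. (\<Sum>j<N. if I j i then u j else 0)\<^sup>2) = real q * (\<Sum>j<N. (u j)\<^sup>2) + (\<Sum>j<N. u j)\<^sup>2"
proof -
  have codeg': "real (card {i. i < N \<and> I j i \<and> I l i}) = 1 + (if j = l then real q else 0)"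
    if "j < N" "l < N" for j l
    using codeg[OF that] deg[OF that(1)] by auto
  have "(\<Sum>i<N. (\<Sum>j<N. if I j i then u j else 0)\<^sup>2)
      = (\<Sum>i<N. \<Sum>j<N. \<Sum>l<N. (if I j i then u j else 0) * (if I l i then u l else 0))"
    by (simp add: power2_eq_square sum_product)
  also have "\<dots> = (\<Sum>j<N. \<Sum>i<N. \<Sum>l<N. (if I j i then u j else 0) * (if I l i then u l else 0))"
    by (rule sum.swap)
  also have "\<dots> = (\<Sum>j<N. \<Sum>l<N. \<Sum>i<N. (if I j i then u j else 0) * (if I l i then u l else 0))"
    by (intro sum.cong refl sum.swap)
  also have "\<dots> = (\<Sum>j<N. \<Sum>l<N. u j * u l + (if j = l then real q * (u j)\<^sup>2 else 0))"
  proof (intro sum.cong refl)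
    fix j l assume "j \<in> {..<N}" "l \<in> {..<N}"
    hence jl: "j < N" "l < N" by auto
    have "(\<Sum>i<N. (if I j i then u j else 0) * (if I l i then u l else 0))
        = (\<Sum>i<N. if I j i \<and> I l i then u j * u l else 0)"
      by (intro sum.cong) auto
    also have "\<dots> = (\<Sum>i | i < N \<and> I j i \<and> I l i. u j * u l)"
      by (subst sum.inter_filter[symmetric]) (auto intro!: sum.cong)
    also have "\<dots> = u j * u l + (if j = l then real q * (u j)\<^sup>2 else 0)"
      using codeg'[OF jl] by (auto simp: power2_eq_square algebra_simps)
    finally show "(\<Sum>i<N. (if I j i then u j else 0) * (if I l i then u l else 0))
        = u j * u l + (if j = l then real q * (u j)\<^sup>2 else 0)" .
  qed
  also have "\<dots> = real q * (\<Sum>j<N. (u j)\<^sup>2) + (\<Sum>j<N. u j)\<^sup>2"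
    by (simp add: sum.distrib sum_distrib_left) (simp add: power2_eq_square sum_product)
  finally show ?thesis .
qed

text \<open>Vertices \<open>i < N\<close> stand for points and \<open>N + i\<close> for lines.
  Doubling turns a point incident with its own polar line into an ordinary edge, so no loops
  arise.\<close>

definition bipartite_double :: "nat \<Rightarrow> (nat \<Rightarrow> nat \<Rightarrow> bool) \<Rightarrow> nat pair_pre_digraph" where
  "bipartite_double N I = \<lparr>pverts = {..<2 * N},
     parcs = {(i, N + j) | i j. i < N \<and> j < N \<and> I i j} \<union> {(N + i, j) | i j. i < N \<and> j < N \<and> I i j}\<rparr>"

lemma pverts_bipartite_double [simp]: "pverts (bipartite_double N I) = {..<2 * N}"
  by (simp add: bipartite_double_def)

lemma parcs_bipartite_double [simp]:
  assumes "i < N" "j < N"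
  shows "(i, j) \<notin> parcs (bipartite_double N I)" "(N + i, N + j) \<notin> parcs (bipartite_double N I)"
    "(i, N + j) \<in> parcs (bipartite_double N I) \<longleftrightarrow> I i j"
    "(N + i, j) \<in> parcs (bipartite_double N I) \<longleftrightarrow> I i j"
  using assms by (auto simp: bipartite_double_def)

lemma pair_graph_bipartite_double:
  assumes "\<And>i j. I i j \<longleftrightarrow> I j i"
  shows "pair_graph (bipartite_double N I)"
proof
  let ?G = "bipartite_double N I"
  have sub: "parcs ?G \<subseteq> {..<2 * N} \<times> {..<2 * N}" by (auto simp: bipartite_double_def)
  show "fst e \<in> pverts ?G" "snd e \<in> pverts ?G" "fst e \<noteq> snd e" if "e \<in> parcs ?G" for e
    using that by (auto simp: bipartite_double_def)
  show "finite (pverts ?G)" by simp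
  show "finite (parcs ?G)" using sub by (rule finite_subset) simp
  show "symmetric (with_proj ?G)"
    using assms by (auto simp: symmetric_def sym_def bipartite_double_def)
qed

lemma max_degree_bipartite_double:
  assumes N: "N > 0" and deg: "\<And>i. i < N \<Longrightarrow> card {j. j < N \<and> I i j} = r"
  shows "max_degree (bipartite_double N I) = r"
proof -
  let ?G = "bipartite_double N I"
  have "out_degree (with_proj ?G) v = r" if v: "v < 2 * N" for v
  proof (cases "v < N")
    case True
    have "out_arcs (with_proj ?G) v = (\<lambda>j. (v, N + j)) ` {j. j < N \<and> I v j}"
      using True by (auto simp: out_arcs_def bipartite_double_def)
    thus ?thesis using deg[OF True] by (simp add: out_degree_def card_image inj_on_def)
  next
    case False
    then obtain i where i: "v = N + i" "i < N" using v by (auto simp: not_less dest!: le_Suc_ex)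
    have "out_arcs (with_proj ?G) v = (\<lambda>j. (v, j)) ` {j. j < N \<and> I i j}"
      using i by (auto simp: out_arcs_def bipartite_double_def)
    thus ?thesis using deg[OF i(2)] by (simp add: out_degree_def card_image inj_on_def)
  qed
  hence "out_degree (with_proj ?G) ` pverts ?G = (\<lambda>_. r) ` {..<2 * N}"
    unfolding pverts_bipartite_double by (intro image_cong) auto
  also have "\<dots> = {r}" using N by (auto simp: image_constant_conv lessThan_empty_iff)
  finally show ?thesis by (simp add: max_degree_def)
qed

lemma sum_lessThan_double:
  fixes f :: "nat \<Rightarrow> 'a :: comm_monoid_add"
  shows "(\<Sum>i<2 * N. f i) = (\<Sum>i<N. f i) + (\<Sum>i<N. f (N + i))"
  using sum.atLeastLessThan_concat[of 0 N "2 * N" f] sum.shift_bounds_nat_ivl[of f 0 N N]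
  by (simp add: lessThan_atLeast0 add.commute mult_2)

text \<open>An eigenvector splits into a point half and a line half, of squared norms
  \<open>U\<close> and \<open>W\<close>. The eigenvalue equation expresses \<open>x\<close> times
  each half by the other, and \<open>sum_squares_incidence\<close> bounds
  \<open>x\<^sup>2 * U\<close> below by \<open>q * W\<close> and \<open>x\<^sup>2 * W\<close> by
  \<open>q * U\<close>.\<close>

lemma eigenvalue_bipartite_double:
  assumes sym: "\<And>i j. I i j \<longleftrightarrow> I j i"
    and deg: "\<And>j. j < N \<Longrightarrow> card {i. i < N \<and> I j i} = q + 1"
    and codeg: "\<And>j l. j < N \<Longrightarrow> l < N \<Longrightarrow> j \<noteq> l \<Longrightarrow> card {i. i < N \<and> I j i \<and> I l i} = 1"
    and ev: "eigenvalue (adj_matrix (bipartite_double N I)) x"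
  shows "real q \<le> x\<^sup>2"
proof -
  let ?G = "bipartite_double N I" and ?n = "2 * N"
  let ?A = "adj_matrix ?G"
  have A: "?A \<in> carrier_mat ?n ?n" using adj_matrix_carrier[of ?G] by simp
  obtain v where v: "v \<in> carrier_vec ?n" "v \<noteq> 0\<^sub>v ?n" "?A *\<^sub>v v = x \<cdot>\<^sub>v v"
    using ev A unfolding eigenvalue_def eigenvector_def by auto
  have vs: "sorted_list_of_set {..<?n} ! i = i" if "i < ?n" for i
    using that by (simp add: lessThan_atLeast0)
  have entry: "?A $$ (i, j) = (if (i, j) \<in> parcs ?G then 1 else 0)" if "i < ?n" "j < ?n" for i j
    using that by (simp add: adj_matrix_index vs)
  have row: "x * v $ i = (\<Sum>j<?n. if (i, j) \<in> parcs ?G then v $ j else 0)" if i: "i < ?n" for i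
  proof -
    have "x * v $ i = (?A *\<^sub>v v) $ i" using i v by simp
    also have "\<dots> = (\<Sum>j<?n. ?A $$ (i, j) * v $ j)"
      using i v(1) A by (auto simp: scalar_prod_def lessThan_atLeast0 intro!: sum.cong)
    also have "\<dots> = (\<Sum>j<?n. if (i, j) \<in> parcs ?G then v $ j else 0)"
      using i by (intro sum.cong) (auto simp: entry)
    finally show ?thesis .
  qed
  have left: "x * v $ i = (\<Sum>j<N. if I j i then v $ (N + j) else 0)" if "i < N" for i
    using row[of i] that sym by (simp add: sum_lessThan_double)
  have right: "x * v $ (N + i) = (\<Sum>j<N. if I j i then v $ j else 0)" if "i < N" for i
    using row[of "N + i"] that sym by (simp add: sum_lessThan_double)
  define U where "U = (\<Sum>i<N. (v $ i)\<^sup>2)"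
  define W where "W = (\<Sum>i<N. (v $ (N + i))\<^sup>2)"
  have "x\<^sup>2 * U = (\<Sum>i<N. (x * v $ i)\<^sup>2)" by (simp add: U_def sum_distrib_left power_mult_distrib)
  also have "\<dots> = (\<Sum>i<N. (\<Sum>j<N. if I j i then v $ (N + j) else 0)\<^sup>2)"
    by (intro sum.cong) (simp_all add: left)
  also have "\<dots> = real q * W + (\<Sum>j<N. v $ (N + j))\<^sup>2"
    unfolding W_def by (rule sum_squares_incidence[OF deg codeg])
  finally have "real q * W \<le> x\<^sup>2 * U" by simp
  have "x\<^sup>2 * W = (\<Sum>i<N. (x * v $ (N + i))\<^sup>2)"
    by (simp add: W_def sum_distrib_left power_mult_distrib)
  also have "\<dots> = (\<Sum>i<N. (\<Sum>j<N. if I j i then v $ j else 0)\<^sup>2)"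
    by (intro sum.cong) (simp_all add: right)
  also have "\<dots> = real q * U + (\<Sum>j<N. v $ j)\<^sup>2"
    unfolding U_def by (rule sum_squares_incidence[OF deg codeg])
  finally have "real q * U \<le> x\<^sup>2 * W" by simp
  \<comment> \<open>Adding the two bounds requires only \<open>U + W > 0\<close>, so neither half
    has to be shown nonzero separately.\<close>
  with \<open>real q * W \<le> x\<^sup>2 * U\<close> have "real q * (U + W) \<le> x\<^sup>2 * (U + W)" by (simp add: algebra_simps)
  moreover have "U + W > 0"
  proof -
    obtain i where "i < ?n" "v $ i \<noteq> 0" using v(1,2) by (metis eq_vecI carrier_vecD index_zero_vec)
    hence "(\<Sum>i<?n. (v $ i)\<^sup>2) > 0" by (intro sum_pos2[of _ i]) auto
    thus ?thesis by (simp add: U_def W_def sum_lessThan_double)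
  qed
  ultimately show ?thesis by simp
qed

text \<open>Since every eigenvalue has square at least \<open>q\<close>, it suffices to look at one
  median. With \<open>2 * N\<close> vertices the zero-based position \<open>N\<close> is the second
  of the two.\<close>

lemma sqrt_le_HL_index_bipartite_double:
  assumes N: "N > 0" and sym: "\<And>i j. I i j \<longleftrightarrow> I j i"
    and deg: "\<And>j. j < N \<Longrightarrow> card {i. i < N \<and> I j i} = q + 1"
    and codeg: "\<And>j l. j < N \<Longrightarrow> l < N \<Longrightarrow> j \<noteq> l \<Longrightarrow> card {i. i < N \<and> I j i \<and> I l i} = 1"
  shows "sqrt (real q) \<le> HL_index (bipartite_double N I)"
proof -
  let ?G = "bipartite_double N I"
  let ?x = "eigenvalue_list ?G ! N"
  note G = eigenvalue_list[OF pair_graph_bipartite_double[where I = I, OF sym]]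
  have "?x \<in> set (eigenvalue_list ?G)" using G(2) N by (intro nth_mem) simp
  hence "poly (char_poly (adj_matrix ?G)) ?x = 0"
    unfolding G(1) by (auto simp: poly_prod_list prod_list_zero_iff o_def)
  hence "eigenvalue (adj_matrix ?G) ?x"
    using eigenvalue_root_char_poly[OF adj_matrix_carrier] by blast
  hence "real q \<le> ?x\<^sup>2" by (intro eigenvalue_bipartite_double[where I = I and N = N] sym deg codeg)
  hence "sqrt (real q) \<le> \<bar>?x\<bar>" by (simp add: real_le_lsqrt real_sqrt_le_iff flip: real_sqrt_abs)
  thus ?thesis unfolding HL_index_altdef Let_def by simp
qed

section \<open>The bounds\<close>

theorem theorem1:
  shows "(\<forall>d::real. d > 0 \<longrightarrow> HL_avg_degree_sup d \<le> ereal (sqrt d)) \<and>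
         (\<forall>(d::int) (p::nat) (k::nat). prime p \<and> k \<ge> 1 \<and> d = int p ^ k + 1 \<longrightarrow>
            HL_max_degree_sup (real_of_int d) \<ge> ereal (sqrt (real_of_int d - 1)))"
proof (intro conjI allI impI)
  fix d :: real assume "d > 0"
  show "HL_avg_degree_sup d \<le> ereal (sqrt d)"
    unfolding HL_avg_degree_sup_def
  proof (rule SUP_least)
    fix G :: "nat pair_pre_digraph"
    assume "G \<in> {G. pair_graph G \<and> pverts G \<noteq> {} \<and> avg_degree G \<le> d}"
    hence "HL_index G \<le> sqrt (avg_degree G)" "sqrt (avg_degree G) \<le> sqrt d"
      using HL_index_le_sqrt_avg_degree by auto
    hence "HL_index G \<le> sqrt d" by (rule order_trans)
    thus "ereal (HL_index G) \<le> ereal (sqrt d)" by simp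
  qed
next
  fix d :: int and p k :: nat
  assume d: "prime p \<and> k \<ge> 1 \<and> d = int p ^ k + 1"
  hence pk: "prime p" "k \<ge> 1" by auto
  from polarity_exists[OF pk] obtain N :: nat and I where N: "N > 0"
    and *: "\<forall>i j. I i j \<longleftrightarrow> I j i" "\<forall>i<N. card {j. j < N \<and> I i j} = p ^ k + 1"
      "\<forall>i<N. \<forall>j<N. i \<noteq> j \<longrightarrow> card {l. l < N \<and> I i l \<and> I j l} = 1"
    by (elim exE conjE)
  note sym = *(1)[rule_format] and deg = *(2)[rule_format] and codeg = *(3)[rule_format]
  let ?G = "bipartite_double N I"
  have "ereal (sqrt (real_of_int d - 1)) \<le> ereal (HL_index ?G)"
    using sqrt_le_HL_index_bipartite_double[where I = I, OF N sym deg codeg] d by simp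
  also have "\<dots> \<le> HL_max_degree_sup (real_of_int d)"
    unfolding HL_max_degree_sup_def
    using pair_graph_bipartite_double[where I = I, OF sym] max_degree_bipartite_double[where I = I, OF N deg] N d
    by (intro SUP_upper) (auto simp: lessThan_empty_iff)
  finally show "ereal (sqrt (real_of_int d - 1)) \<le> HL_max_degree_sup (real_of_int d)" .
qed

end
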